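(* Let $m\ge1$, $n=2m+1$, and let $r\ge0$ be an integer. Then $$\mathfrak{F}(4r+1,(2r+1)\ (\bmod\ n))=-\sum_{j=1}^m\left(\mathfrak{F}(2r+1,(r+j)\ (\bmod\ n))\right)^2,$$ $$2\,\mathfrak{F}(4r+3,(2r+2)\ (\bmod\ n))=\mathfrak{F}(4r+4,(2r+2)\ (\bmod\ n))$$ $$=\left(\mathfrak{F}(2r+2,(r+1)\ (\bmod\ n))\right)^2+2\sum_{j=1}^m\left(\mathfrak{F}(2r+2,(r+j+1)\ (\bmod\ n))\right)^2.$$ The corresponding combinatorial identities are $$\sum_{a=-\infty}^{\infty}(-1)^a\binom{4r+1}{2r+1+an}=\sum_{j=1}^m\left(\sum_{a=-\infty}^{\infty}(-1)^{r+j+a}\binom{2r+1}{r+j+an}\right)^2,$$ $$2\sum_{a=-\infty}^{\infty}(-1)^a\binom{4r+3}{2r+2+an}=\sum_{a=-\infty}^{\infty}(-1)^a\binom{4r+4}{2r+2+an}$$ $$=\left(\sum_{a=-\infty}^{\infty}(-1)^{r+1+a}\binom{2r+2}{r+1+an}\right)^2+2\sum_{j=1}^m\left(\sum_{a=-\infty}^{\infty}(-1)^{r+j+1+a}\binom{2r+2}{r+j+1+an}\right)^2.$$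
   Context: Fleck numbers: $\mathfrak{F}(N,a\ (\bmod\ n))=\sum_{k\equiv a\ (\mathrm{mod}\ n)}(-1)^k\binom Nk$. Binomial coefficients $\binom{N}{k}$ with $k<0$ or $k>N$ are $0$, so all sums are finite. *)

theory Defs
  imports Complex_Main "HOL-Library.Groups_Big_Fun" "HOL-Number_Theory.Cong"
begin

(* The lower index ranges over all integers; the coefficient vanishes outside 0..N. *)
definition binomZ :: "nat \<Rightarrow> int \<Rightarrow> int" where
  "binomZ N k = (if k < 0 then 0 else int (N choose nat k))"

(* (-1)^k for an integer exponent k; the library's powi is not available on type int. *)
definition sgnpow :: "int \<Rightarrow> int" where
  "sgnpow k = (if even k then 1 else -1)"

lemma sgnpow_eq_powi: "of_int (sgnpow k) = (-1 :: real) powi k"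
  by (simp add: sgnpow_def power_int_minus_one_minus power_int_minus_left)

lemma binomZ_eq_0: "k < 0 \<or> int N < k \<Longrightarrow> binomZ N k = 0"
  by (auto simp: binomZ_def intro!: binomial_eq_0)

(* Sum_any is the sum over all integers of a finitely supported function; it would be 0 by
   convention for infinite support, which the lemmas below exclude. *)
definition fleck :: "nat \<Rightarrow> int \<Rightarrow> nat \<Rightarrow> int" where
  "fleck N a n =
     Sum_any (\<lambda>k::int. if [k = a] (mod int n) then sgnpow k * binomZ N k else 0)"

lemma finite_support_fleck:
  "finite {k::int. (if [k = a] (mod int n) then sgnpow k * binomZ N k else 0) \<noteq> 0}"
  by (rule finite_subset[of _ "{0..int N}"]) (auto simp: binomZ_eq_0 not_less split: if_splits
      intro!: leI)

lemma finite_support_progression: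
  assumes "n > 0"
  shows "finite {a::int. s a * binomZ N (b + a * int n) \<noteq> 0}"
proof (rule finite_subset)
  show "{a::int. s a * binomZ N (b + a * int n) \<noteq> 0}
          \<subseteq> (\<lambda>a. b + a * int n) -` {0..int N}"
    using binomZ_eq_0[of _ N] by (fastforce simp: not_le)
  show "finite ((\<lambda>a. b + a * int n) -` {0..int N})"
    using assms by (intro finite_vimageI) (auto simp: inj_on_def)
qed

end

theory Submission
  imports Defs
begin

text \<open>
  Modulo \<open>x ^ n - 1\<close> the coefficients of \<open>(1 - x) ^ N\<close> are exactly the Fleck numbers
  \<open>fleck N a n\<close>, indexed by the residues \<open>a\<close>.  Multiplying by \<open>1 - x\<close> gives a Pascal
  recurrence (\<open>fleck_Suc\<close>), multiplying \<open>(1 - x) ^ M\<close> with \<open>(1 - x) ^ N\<close> gives a cyclic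
  convolution (\<open>fleck_convolution\<close>), and the symmetry of the binomial coefficients gives
  \<open>fleck N (N - a) n = (-1) ^ N * fleck N a n\<close> (\<open>fleck_symmetric\<close>).

  Convolving \<open>(1 - x) ^ N\<close> with itself and reading off the residue \<open>N\<close>, the symmetry turns
  every product \<open>fleck N a n * fleck N (N - a) n\<close> into a signed square, so
  \<open>fleck (2 * N) N n\<close> is \<open>(-1) ^ N\<close> times the sum of all squares \<open>(fleck N a n)\<^sup>2\<close> over a full
  residue system.  The reflection \<open>a \<mapsto> N - a\<close> pairs equal squares and, as \<open>n\<close> is odd, has
  exactly one fixed residue.  For \<open>N = 2 * r + 2\<close> this residue is \<open>r + 1\<close>, which gives the
  isolated square.  For \<open>N = 2 * r + 1\<close> it is \<open>r + m + 1\<close>, where antisymmetry forces the Fleck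
  number to vanish.  Finally, one Pascal step together with the symmetry gives
  \<open>fleck (2 * N) N n = 2 * fleck (2 * N - 1) N n\<close>.

  The binomial identities are the same statements with \<open>k = b + a * n\<close> substituted; since \<open>n\<close>
  is odd, \<open>(-1) ^ k = (-1) ^ (b + a)\<close>.
\<close>

section \<open>Pascal recurrence and symmetry\<close>

lemma binomZ_Suc: "binomZ (Suc N) k = binomZ N k + binomZ N (k - 1)"
proof (cases "k \<le> 0")
  case True
  then show ?thesis by (auto simp: binomZ_def)
next
  case False
  then obtain i where "k = int (Suc i)"
    by (metis not_le zero_less_imp_eq_int gr0_conv_Suc)
  moreover from this have "nat k = Suc i" "nat (k - 1) = i" by auto
  ultimately show ?thesis by (simp add: binomZ_def)
qed

lemma fleck_cong:
  assumes "[a = b] (mod int n)"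
  shows "fleck N a n = fleck N b n"
  using assms by (simp add: fleck_def cong_def)

lemma fleck_periodic: "fleck N (a + int n) n = fleck N a n"
  by (rule fleck_cong) (simp add: cong_def)

lemma fleck_0: "fleck 0 a n = (if [0 = a] (mod int n) then 1 else 0)"
proof -
  have "fleck 0 a n = Sum_any (\<lambda>k::int. if k = 0 then (if [0 = a] (mod int n) then 1 else 0) else 0)"
    unfolding fleck_def
    by (rule Sum_any.cong) (auto simp: binomZ_def sgnpow_def)
  also have "\<dots> = (if [0 = a] (mod int n) then 1 else 0)"
    by (cases "[0 = a] (mod int n)") (simp_all add: Sum_any.expand_set)
  finally show ?thesis .
qed

lemma fleck_Suc: "fleck (Suc N) a n = fleck N a n - fleck N (a - 1) n"
proof -
  let ?f = "\<lambda>N a k::int. if [k = a] (mod int n) then sgnpow k * binomZ N k else 0"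
  have fin: "finite {k. ?f N a k \<noteq> 0}" for N a
    by (rule finite_support_fleck)
  have shift: "?f N (a - 1) (k - 1) = (if [k = a] (mod int n) then - sgnpow k * binomZ N (k - 1) else 0)" for k
    using cong_add_rcancel[of "k - 1" 1 "a - 1" "int n"] by (auto simp: sgnpow_def)
  have split: "?f (Suc N) a k = ?f N a k + - ?f N (a - 1) (k - 1)" for k
    unfolding shift by (simp add: binomZ_Suc algebra_simps)
  have bij: "bij (\<lambda>k::int. k - 1)"
    by (rule bij_betw_byWitness[where f' = "\<lambda>k. k + 1"]) auto
  have "finite ((\<lambda>k. k - 1) -` {k. ?f N (a - 1) k \<noteq> 0})"
    by (intro finite_vimageI fin bij_is_inj bij)
  then have fin': "finite {k. - ?f N (a - 1) (k - 1) \<noteq> 0}"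
    by (simp add: vimage_def)
  have "fleck (Suc N) a n = Sum_any (\<lambda>k. ?f N a k + - ?f N (a - 1) (k - 1))"
    unfolding fleck_def split ..
  also have "\<dots> = Sum_any (?f N a) + Sum_any (\<lambda>k. - ?f N (a - 1) (k - 1))"
    by (rule Sum_any.distrib[OF fin fin'])
  also have "Sum_any (\<lambda>k. - ?f N (a - 1) (k - 1)) = Sum_any (\<lambda>k. - ?f N (a - 1) k)"
    by (rule Sum_any.reindex_cong[OF bij, symmetric]) (simp add: o_def)
  also have "\<dots> = - Sum_any (?f N (a - 1))"
    by (simp add: Sum_any.expand_set sum_negf)
  finally show ?thesis by (simp add: fleck_def)
qed

text \<open>
  This is \<open>k \<mapsto> N - k\<close> in the defining sum.  It also follows from the Pascal rule alone: the
  reflection swaps the two terms of the rule, and each swap contributes one factor \<open>-1\<close>.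
\<close>

lemma fleck_symmetric: "fleck N (int N - a) n = (-1) ^ N * fleck N a n"
proof (induction N arbitrary: a)
  case 0
  have "[0 = - a] (mod int n) \<longleftrightarrow> [0 = a] (mod int n)"
    using cong_minus_minus_iff[of 0 a "int n"] by simp
  then show ?case by (simp add: fleck_0)
next
  case (Suc N)
  have "fleck (Suc N) (int (Suc N) - a) n
      = fleck N (int N - (a - 1)) n - fleck N (int N - a) n"
    by (simp add: fleck_Suc algebra_simps)
  then show ?case
    unfolding Suc.IH by (simp add: fleck_Suc algebra_simps)
qed

section \<open>Cyclic convolution\<close>

lemma sum_period_shift:
  fixes f :: "int \<Rightarrow> 'a::comm_monoid_add"
  assumes per: "\<And>x. f (x + int n) = f x"
  shows "sum f {s..<s + int n} = sum f {t..<t + int n}"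
proof -
  have step: "sum f {x..<x + int n} = sum f {x + 1..<x + 1 + int n}" for x
  proof (cases "n = 0")
    case False
    then have "{x..<x + int n} = insert x {x + 1..<x + int n}"
      and "{x + 1..<x + 1 + int n} = insert (x + int n) {x + 1..<x + int n}"
      by auto
    then show ?thesis by (simp add: per)
  qed simp
  show ?thesis
  proof (induction s rule: int_induct[where k = t])
    case (step1 i)
    then show ?case using step[of i] by simp
  next
    case (step2 i)
    then show ?case using step[of "i - 1"] by simp
  qed simp
qed

text \<open>
  Induction on \<open>M\<close>: the two terms of the Pascal rule produce the convolutions at \<open>c\<close> and, after
  moving the window of summation by one, at \<open>c - 1\<close>.
\<close>

lemma fleck_convolution:
  assumes "n > 0"
  shows "(\<Sum>i\<in>{s..<s + int n}. fleck M i n * fleck N (c - i) n) = fleck (M + N) c n"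
proof (induction M arbitrary: c)
  case 0
  let ?g = "\<lambda>i. fleck 0 i n * fleck N (c - i) n"
  have per: "?g (x + int n) = ?g x" for x
    using fleck_periodic[of N "c - (x + int n)" n] by (simp add: fleck_periodic)
  have "?g i = (if i = 0 then fleck N c n else 0)" if "i \<in> {0..<0 + int n}" for i
    using that by (auto simp: fleck_0 cong_def)
  then have "sum ?g {0..<0 + int n} = (\<Sum>i\<in>{0..<0 + int n}. if i = 0 then fleck N c n else 0)"
    by (rule sum.cong[OF refl])
  also have "\<dots> = fleck N c n"
    using assms by simp
  finally show ?case
    using sum_period_shift[of ?g n s 0, OF per] by simp
next
  case (Suc M)
  let ?h = "\<lambda>i. fleck M (i - 1) n * fleck N (c - i) n"
  have per: "?h (x + int n) = ?h x" for x
    using fleck_periodic[of N "c - (x + int n)" n] fleck_periodic[of M "x - 1" n]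
    by (simp add: algebra_simps)
  have "sum ?h {s..<s + int n} = sum ?h {s + 1..<s + 1 + int n}"
    by (rule sum_period_shift[of ?h, OF per])
  also have "\<dots> = (\<Sum>i\<in>{s..<s + int n}. fleck M i n * fleck N (c - 1 - i) n)"
    by (rule sum.reindex_bij_witness[where i = "\<lambda>i. i + 1" and j = "\<lambda>i. i - 1"]) auto
  finally have "sum ?h {s..<s + int n} = fleck (M + N) (c - 1) n"
    unfolding Suc.IH .
  then show ?case
    using Suc.IH[of c] by (simp add: fleck_Suc left_diff_distrib sum_subtractf)
qed

lemma fleck_self_convolution:
  assumes "n > 0"
  shows "fleck (2 * N) (int N) n = (-1) ^ N * (\<Sum>i\<in>{s..<s + int n}. (fleck N i n)\<^sup>2)"
proof -
  have "fleck (2 * N) (int N) n = (\<Sum>i\<in>{s..<s + int n}. fleck N i n * fleck N (int N - i) n)"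
    by (simp only: fleck_convolution[OF assms] mult_2)
  also have "\<dots> = (\<Sum>i\<in>{s..<s + int n}. (-1) ^ N * (fleck N i n)\<^sup>2)"
    by (simp add: fleck_symmetric power2_eq_square mult_ac)
  finally show ?thesis by (simp add: sum_distrib_left)
qed

text \<open>
  The two terms of the Pascal rule at the middle index are reflections of each other in the odd
  row \<open>2 * N - 1\<close>, hence negatives of each other.
\<close>

lemma fleck_double:
  assumes "N > 0"
  shows "fleck (2 * N) (int N) n = 2 * fleck (2 * N - 1) (int N) n"
proof -
  obtain M where M: "2 * N = Suc M" "2 * N - 1 = M" and "odd M"
    using assms by (intro that[of "2 * N - 1"]) auto
  have "int M - int N = int N - 1"
    using M by linarith
  then have "fleck M (int N - 1) n = - fleck M (int N) n"
    using fleck_symmetric[of M "int N" n] \<open>odd M\<close> by simp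
  then show ?thesis
    unfolding M by (simp add: fleck_Suc)
qed

section \<open>Folding a residue system under reflection\<close>

lemma sum_window_about_center:
  fixes f :: "int \<Rightarrow> 'a::comm_monoid_add"
  shows "(\<Sum>i\<in>{c - int m..<c + int m + 1}. f i) = f c + (\<Sum>j=1..m. f (c + int j) + f (c - int j))"
proof (induction m)
  case 0
  have "{c..<c + 1} = {c}" by auto
  then show ?case by simp
next
  case (Suc m)
  have "{c - int (Suc m)..<c + int (Suc m) + 1} =
      insert (c - int (Suc m)) (insert (c + int (Suc m)) {c - int m..<c + int m + 1})"
    by auto
  then show ?case using Suc by (simp add: add_ac)
qed

lemma sum_window_about_half_integer:
  fixes f :: "int \<Rightarrow> 'a::comm_monoid_add"
  shows "(\<Sum>i\<in>{c + 1 - int m..<c + int m + 1}. f i) = (\<Sum>j=1..m. f (c + int j) + f (c + 1 - int j))"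
proof (induction m)
  case 0
  then show ?case by simp
next
  case (Suc m)
  have "{c + 1 - int (Suc m)..<c + int (Suc m) + 1} =
      insert (c + 1 - int (Suc m)) (insert (c + int (Suc m)) {c + 1 - int m..<c + int m + 1})"
    by auto
  then show ?case using Suc by (simp add: add_ac)
qed

text \<open>The window is centred at the fixed residue \<open>r + 1\<close> of the reflection \<open>i \<mapsto> 2 * r + 2 - i\<close>.\<close>

lemma fleck_even_fold:
  assumes "n = 2 * m + 1"
  shows "fleck (4 * r + 4) (2 * int r + 2) n
    = (fleck (2 * r + 2) (int r + 1) n)\<^sup>2 + 2 * (\<Sum>j=1..m. (fleck (2 * r + 2) (int r + int j + 1) n)\<^sup>2)"
proof -
  let ?N = "2 * r + 2" and ?c = "int r + 1"
  have reflect: "fleck ?N (?c - int j) n = fleck ?N (int r + int j + 1) n" for j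
    using fleck_symmetric[of ?N "int r + int j + 1" n] by (simp add: algebra_simps)
  have order: "?c + int j = int r + int j + 1" for j
    by simp
  have window: "?c - int m + int n = ?c + int m + 1"
    using assms by simp
  have "fleck (2 * ?N) (int ?N) n = (\<Sum>i\<in>{?c - int m..<?c + int m + 1}. (fleck ?N i n)\<^sup>2)"
    using fleck_self_convolution[where n = n and N = ?N and s = "?c - int m"] assms
    unfolding window by simp
  also have "\<dots> = (fleck ?N ?c n)\<^sup>2 + (\<Sum>j=1..m. 2 * (fleck ?N (int r + int j + 1) n)\<^sup>2)"
    unfolding sum_window_about_center unfolding reflect order by (simp only: mult_2[where 'a = int])
  also have "2 * ?N = 4 * r + 4" by simp
  also have "int ?N = 2 * int r + 2" by simp
  finally show ?thesis by (simp only: sum_distrib_left)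
qed

text \<open>
  The reflection \<open>i \<mapsto> 2 * r + 1 - i\<close> of the integers has no fixed point, but modulo \<open>n\<close> it
  fixes \<open>r + m + 1\<close>.  The window puts that residue last; the other \<open>2 * m\<close> residues pair up
  around \<open>r + 1/2\<close>.
\<close>

lemma fleck_odd_fold:
  assumes "n = 2 * m + 1"
  shows "fleck (4 * r + 2) (2 * int r + 1) n
    = - 2 * (\<Sum>j=1..m. (fleck (2 * r + 1) (int r + int j) n)\<^sup>2)"
proof -
  let ?N = "2 * r + 1" and ?c = "int r + int m + 1"
  have vanish: "fleck ?N ?c n = 0"
  proof -
    have "fleck ?N (int ?N - ?c) n = - fleck ?N ?c n"
      by (simp only: fleck_symmetric) simp
    moreover have "int ?N - ?c + int n = ?c"
      using assms by simp
    ultimately show ?thesis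
      using fleck_periodic[of ?N "int ?N - ?c" n] by presburger
  qed
  have reflect: "fleck ?N (int r + 1 - int j) n = - fleck ?N (int r + int j) n" for j
    using fleck_symmetric[of ?N "int r + int j" n] by (simp add: algebra_simps)
  have window: "{int r + 1 - int m..<int r + 1 - int m + int n}
      = insert ?c {int r + 1 - int m..<int r + int m + 1}"
    using assms by auto
  have "fleck (2 * ?N) (int ?N) n = - (\<Sum>i\<in>{int r + 1 - int m..<int r + int m + 1}. (fleck ?N i n)\<^sup>2)"
    using fleck_self_convolution[where n = n and N = ?N and s = "int r + 1 - int m"] assms vanish
    unfolding window by simp
  also have "\<dots> = - (\<Sum>j=1..m. 2 * (fleck ?N (int r + int j) n)\<^sup>2)"
    by (simp only: sum_window_about_half_integer reflect power2_minus mult_2[where 'a = int])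
  also have "2 * ?N = 4 * r + 2" by simp
  also have "int ?N = 2 * int r + 1" by simp
  finally show ?thesis by (simp add: sum_distrib_left sum_negf)
qed

section \<open>Sums over an arithmetic progression\<close>

lemma fleck_eq_progression:
  assumes "odd n"
  shows "Sum_any (\<lambda>a::int. sgnpow (b + a) * binomZ N (b + a * int n)) = fleck N b n"
proof -
  have n: "n > 0"
    using assms by (cases n) auto
  have sgn: "sgnpow (b + a * int n) = sgnpow (b + a)" for a
    using assms by (simp add: sgnpow_def)
  have progression: "b + (k - b) div int n * int n = k" if "[k = b] (mod int n)" for k
    using that by (simp add: cong_iff_dvd_diff)
  have on: "[b + a * int n = b] (mod int n)" for a
    by (simp add: cong_def)
  show ?thesis
    unfolding fleck_def Sum_any.expand_set
  proof (rule sum.reindex_bij_witness[where j = "\<lambda>a. b + a * int n" and i = "\<lambda>k. (k - b) div int n"])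
    fix k
    assume "k \<in> {k. (if [k = b] (mod int n) then sgnpow k * binomZ N k else 0) \<noteq> 0}"
    then have k: "[k = b] (mod int n)" "sgnpow k * binomZ N k \<noteq> 0"
      by (auto split: if_splits)
    then show "b + (k - b) div int n * int n = k"
      by (rule_tac progression)
    with k(2) show "(k - b) div int n
        \<in> {a. sgnpow (b + a) * binomZ N (b + a * int n) \<noteq> 0}"
      using sgn[of "(k - b) div int n"] by simp
  qed (use n in \<open>simp_all add: on sgn\<close>)
qed

section \<open>The Fleck number identities\<close>

theorem mainTheorem13:
  fixes m n r :: nat
  assumes "m \<ge> 1" and "n = 2 * m + 1"
  shows
    "fleck (4*r+1) (2 * int r + 1) n
       = - (\<Sum>j=1..m. (fleck (2*r+1) (int r + int j) n)^2)
   \<and> 2 * fleck (4*r+3) (2 * int r + 2) n = fleck (4*r+4) (2 * int r + 2) n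
   \<and> fleck (4*r+4) (2 * int r + 2) n
       = (fleck (2*r+2) (int r + 1) n)^2
         + 2 * (\<Sum>j=1..m. (fleck (2*r+2) (int r + int j + 1) n)^2)
   \<and> Sum_any (\<lambda>a::int. sgnpow a * binomZ (4*r+1) (2 * int r + 1 + a * int n))
       = (\<Sum>j=1..m. (Sum_any (\<lambda>a::int.
            sgnpow (int r + int j + a) * binomZ (2*r+1) (int r + int j + a * int n)))^2)
   \<and> 2 * Sum_any (\<lambda>a::int. sgnpow a * binomZ (4*r+3) (2 * int r + 2 + a * int n))
       = Sum_any (\<lambda>a::int. sgnpow a * binomZ (4*r+4) (2 * int r + 2 + a * int n))
   \<and> Sum_any (\<lambda>a::int. sgnpow a * binomZ (4*r+4) (2 * int r + 2 + a * int n))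
       = (Sum_any (\<lambda>a::int.
            sgnpow (int r + 1 + a) * binomZ (2*r+2) (int r + 1 + a * int n)))^2
         + 2 * (\<Sum>j=1..m. (Sum_any (\<lambda>a::int.
            sgnpow (int r + int j + 1 + a) * binomZ (2*r+2) (int r + int j + 1 + a * int n)))^2)"
proof -
  have n: "odd n"
    using assms by simp
  have "2 * (2 * r + 1) = 4 * r + 2" "2 * (2 * r + 1) - 1 = 4 * r + 1" "int (2 * r + 1) = 2 * int r + 1"
    by simp_all
  then have odd_double: "fleck (4 * r + 2) (2 * int r + 1) n = 2 * fleck (4 * r + 1) (2 * int r + 1) n"
    using fleck_double[of "2 * r + 1" n] by (simp only:)
  have "2 * (2 * r + 2) = 4 * r + 4" "2 * (2 * r + 2) - 1 = 4 * r + 3" "int (2 * r + 2) = 2 * int r + 2"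
    by simp_all
  then have even_double: "fleck (4 * r + 4) (2 * int r + 2) n = 2 * fleck (4 * r + 3) (2 * int r + 2) n"
    using fleck_double[of "2 * r + 2" n] by (simp only:)
  have odd_squares: "fleck (4 * r + 1) (2 * int r + 1) n
      = - (\<Sum>j=1..m. (fleck (2 * r + 1) (int r + int j) n)\<^sup>2)"
    using fleck_odd_fold[OF assms(2), of r] odd_double by simp
  note even_squares = fleck_even_fold[OF assms(2), of r]

  \<comment> \<open>Starting the progression at an odd \<open>b\<close> costs a global sign, at an even \<open>b\<close> none.\<close>
  have sgn: "sgnpow (2 * int r + 1 + a) = - sgnpow a" "sgnpow (2 * int r + 2 + a) = sgnpow a" for a
    by (simp_all add: sgnpow_def)
  have odd_start: "Sum_any (\<lambda>a::int. sgnpow a * binomZ (4 * r + 1) (2 * int r + 1 + a * int n))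
      = - fleck (4 * r + 1) (2 * int r + 1) n"
    using fleck_eq_progression[OF n, of "2 * int r + 1" "4 * r + 1", symmetric]
    unfolding sgn by (simp add: Sum_any.expand_set sum_negf)
  have even_start: "Sum_any (\<lambda>a::int. sgnpow a * binomZ N (2 * int r + 2 + a * int n))
      = fleck N (2 * int r + 2) n" for N
    using fleck_eq_progression[OF n, of "2 * int r + 2" N] unfolding sgn .

  show ?thesis
    unfolding odd_start even_start fleck_eq_progression[OF n]
    using odd_squares even_double even_squares by simp
qed

end
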